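(* For all integers $k\ge 1$ and $\ell\ge 0$, there are only finitely many (up to isomorphism) $k$-vertex-critical graphs that are both $(P_4+\ell P_1)$-free and $2P_2$-free.
   Context: All graphs are finite and simple. A graph $G$ is $k$-vertex-critical if $\chi(G)=k$ but $\chi(G-v)<k$ for every $v\in V(G)$. A graph is $H$-free if it has no induced subgraph isomorphic to $H$. $P_n$ is the path on $n$ vertices, $P_1$ a single vertex, $+$ denotes disjoint union, $\ell P_1$ is $\ell$ isolated vertices, and $2P_2$ is the disjoint union of two edges. *)

theory Defs
  imports "Graph_Theory.Graph_Theory"
begin

text \<open>
  A finite simple graph is a \<^typ>\<open>'a pair_pre_digraph\<close> satisfying \<^locale>\<open>pair_graph\<close>:
  an undirected edge uv is represented by the two arcs (u,v) and (v,u). The map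
  \<^const>\<open>with_proj\<close> is the library's embedding of these into \<^typ>\<open>('a, 'b) pre_digraph\<close>,
  on which induced subgraphs, vertex deletion and isomorphism are defined.
\<close>

definition proper_colouring :: "('a, 'b) pre_digraph \<Rightarrow> nat \<Rightarrow> ('a \<Rightarrow> nat) \<Rightarrow> bool" where
  "proper_colouring G n c \<longleftrightarrow>
     c ` verts G \<subseteq> {..<n} \<and> (\<forall>u v. u \<rightarrow>\<^bsub>G\<^esub> v \<longrightarrow> c u \<noteq> c v)"

definition chromatic_number :: "('a, 'b) pre_digraph \<Rightarrow> nat" where
  "chromatic_number G = (LEAST n. \<exists>c. proper_colouring G n c)"

definition vertex_critical :: "nat \<Rightarrow> ('a, 'b) pre_digraph \<Rightarrow> bool" where
  "vertex_critical k G \<longleftrightarrow>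
     chromatic_number G = k \<and>
     (\<forall>v \<in> verts G. chromatic_number (pre_digraph.del_vert G v) < k)"

definition induced_free :: "('c, 'd) pre_digraph \<Rightarrow> ('a, 'b) pre_digraph \<Rightarrow> bool" where
  "induced_free H G \<longleftrightarrow> \<not> (\<exists>K. induced_subgraph K G \<and> digraph_iso K H)"

text \<open>The index counts vertices, so \<open>path_graph 1\<close> is a single vertex.\<close>

definition path_graph :: "nat \<Rightarrow> nat pair_pre_digraph" where
  "path_graph n =
     \<lparr> pverts = {..<n}, parcs = {(i, j). i < n \<and> j < n \<and> (j = Suc i \<or> i = Suc j)} \<rparr>"

definition disjoint_union ::
    "'a pair_pre_digraph \<Rightarrow> 'b pair_pre_digraph \<Rightarrow> ('a + 'b) pair_pre_digraph" where
  "disjoint_union G H =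
     \<lparr> pverts = pverts G <+> pverts H,
       parcs = map_prod Inl Inl ` parcs G \<union> map_prod Inr Inr ` parcs H \<rparr>"

definition copies :: "nat \<Rightarrow> 'a pair_pre_digraph \<Rightarrow> (nat \<times> 'a) pair_pre_digraph" where
  "copies l G =
     \<lparr> pverts = {..<l} \<times> pverts G,
       parcs = {((i, u), (j, v)) | i u j v. i < l \<and> i = j \<and> (u, v) \<in> parcs G} \<rparr>"

lemma pair_graph_path_graph: "pair_graph (path_graph n)"
proof
  show "finite (parcs (path_graph n))"
    by (rule finite_subset[of _ "{..<n} \<times> {..<n}"]) (auto simp: path_graph_def)
qed (auto simp: path_graph_def symmetric_def intro!: symI)

lemma pair_graph_disjoint_union:
  assumes "pair_graph G" "pair_graph H"
  shows "pair_graph (disjoint_union G H)"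
proof -
  interpret G: pair_graph G by fact
  interpret H: pair_graph H by fact
  show ?thesis
    by standard
      (auto simp: disjoint_union_def symmetric_def image_iff G.arcs_symmetric H.arcs_symmetric
         dest: G.wellformed H.wellformed G.pair_no_loops H.pair_no_loops intro!: symI
         intro: bexI[rotated, OF G.arcs_symmetric] bexI[rotated, OF H.arcs_symmetric])
qed

lemma pair_graph_copies:
  assumes "pair_graph G"
  shows "pair_graph (copies l G)"
proof -
  interpret G: pair_graph G by fact
  show ?thesis
  proof
    show "finite (parcs (copies l G))"
    proof (rule finite_subset)
      show "parcs (copies l G) \<subseteq> ({..<l} \<times> pverts G) \<times> ({..<l} \<times> pverts G)"
        by (auto simp: copies_def dest: G.wellformed)
    qed simp
  qed (auto simp: copies_def symmetric_def G.arcs_symmetric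
         dest: G.wellformed G.pair_no_loops intro!: symI)
qed

lemma digraph_iso_with_proj_iff:
  assumes "pair_wf_digraph G"
  shows "digraph_iso (with_proj G) (with_proj H) \<longleftrightarrow>
    (\<exists>f. inj_on f (pverts G) \<and> pverts H = f ` pverts G \<and> parcs H = map_prod f f ` parcs G)"
    (is "?L \<longleftrightarrow> ?R")
proof -
  interpret G: pair_wf_digraph G by fact
  show ?thesis
  proof
    assume ?L
    then obtain h where h: "pre_digraph.digraph_isomorphism (with_proj G) h"
        and H: "with_proj H = app_iso h (with_proj G)"
      unfolding digraph_iso_def by blast
    have V: "pverts H = iso_verts h ` pverts G" and A: "parcs H = iso_arcs h ` parcs G"
        and t: "iso_tail h = fst" and hd: "iso_head h = snd"
      using H by (simp_all add: with_proj_def app_iso_def)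
    have inj: "inj_on (iso_verts h) (pverts G)"
        and e: "\<And>a. a \<in> parcs G \<Longrightarrow>
          iso_verts h (fst a) = fst (iso_arcs h a) \<and> iso_verts h (snd a) = snd (iso_arcs h a)"
      using h t hd by (auto simp: pre_digraph.digraph_isomorphism_def)
    have "iso_arcs h a = map_prod (iso_verts h) (iso_verts h) a" if "a \<in> parcs G" for a
      using e[OF that] by (cases a) (auto intro: prod_eqI)
    then have "parcs H = map_prod (iso_verts h) (iso_verts h) ` parcs G"
      unfolding A by (intro image_cong) auto
    with inj V show ?R by blast
  next
    assume ?R
    then obtain f where inj: "inj_on f (pverts G)" and V: "pverts H = f ` pverts G"
        and A: "parcs H = map_prod f f ` parcs G" by blast
    define h where "h = \<lparr> iso_verts = f, iso_arcs = map_prod f f,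
      iso_head = snd :: 'b \<times> 'b \<Rightarrow> 'b, iso_tail = fst \<rparr>"
    have "inj_on (map_prod f f) (parcs G)"
    proof (rule inj_on_subset[OF map_prod_inj_on[OF inj inj]])
      show "parcs G \<subseteq> pverts G \<times> pverts G" by (auto dest: G.wellformed)
    qed
    then have "pre_digraph.digraph_isomorphism (with_proj G) h"
      using inj G.wf_digraph by (simp add: pre_digraph.digraph_isomorphism_def h_def)
    moreover have "with_proj H = app_iso h (with_proj G)"
      by (simp add: with_proj_def app_iso_def h_def V A)
    ultimately show ?L unfolding digraph_iso_def by blast
  qed
qed

end

theory Submission
  imports Defs "HOL-Library.Ramsey"
begin

text \<open>
  Fix a proper colouring of \<open>G\<close> with \<open>k\<close> colour classes \<open>C\<^sub>0, \<dots>, C\<^sub>k\<^sub>-\<^sub>1\<close>; it suffices to bound the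
  size of one class \<open>S\<close>. As \<open>G\<close> is \<open>2P\<^sub>2\<close>-free and both \<open>S\<close> and \<open>C\<^sub>i\<close> are independent, the sets
  \<open>N(s) \<inter> C\<^sub>i\<close> for \<open>s \<in> S\<close> are pairwise comparable, whereas criticality makes the neighbourhoods
  \<open>N(s)\<close> themselves pairwise incomparable. So an enumeration of \<open>S\<close> assigns to each pair \<open>s < t\<close>
  colours \<open>i, j\<close> such that \<open>N(s) \<inter> C\<^sub>i \<subset> N(t) \<inter> C\<^sub>i\<close> and \<open>N(t) \<inter> C\<^sub>j \<subset> N(s) \<inter> C\<^sub>j\<close>. If \<open>S\<close> is large,
  Ramsey's theorem yields \<open>s\<^sub>0 < \<dots> < s\<^sub>l\<^sub>+\<^sub>1\<close> in \<open>S\<close> with the same \<open>i, j\<close> for all pairs. Then some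
  \<open>x \<in> C\<^sub>i\<close> is adjacent to \<open>s\<^sub>l\<^sub>+\<^sub>1\<close> only and some \<open>y \<in> C\<^sub>j\<close> is adjacent to \<open>s\<^sub>0\<close> only. Since \<open>G\<close> is
  \<open>2P\<^sub>2\<close>-free, \<open>x\<close> and \<open>y\<close> are adjacent, so these vertices induce \<open>P\<^sub>4 + lP\<^sub>1\<close>.
\<close>

section \<open>Ramsey's theorem for ordered pairs\<close>

text \<open>Several relations \<open>R c\<close> may hold for one pair; choosing one of them colours
  the 2-subsets of \<open>{..<N}\<close> with \<open>card C\<close> colours, and Ramsey's theorem
  with target size \<open>q\<close> for every colour applies. As \<open>N\<close> is quantified
  before \<open>R\<close>, it can later serve all graphs at once.\<close>

lemma ramsey_ordered_pairs:
  assumes "finite C"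
  shows "\<exists>N. \<forall>R :: 'c \<Rightarrow> nat \<Rightarrow> nat \<Rightarrow> bool.
    (\<forall>a b. a < b \<and> b < N \<longrightarrow> (\<exists>c\<in>C. R c a b)) \<longrightarrow>
    (\<exists>c\<in>C. \<exists>H\<subseteq>{..<N}. card H = q \<and> (\<forall>a\<in>H. \<forall>b\<in>H. a < b \<longrightarrow> R c a b))"
proof -
  obtain e where e: "bij_betw e {..<card C} C"
    using ex_bij_betw_nat_finite[OF assms] by (auto simp: atLeast0LessThan)
  obtain N :: nat where N: "partn_lst {..<N} (replicate (card C) q) 2"
    using ramsey_full by blast
  show ?thesis
  proof (intro exI allI impI)
    fix R :: "'c \<Rightarrow> nat \<Rightarrow> nat \<Rightarrow> bool"
    assume R: "\<forall>a b. a < b \<and> b < N \<longrightarrow> (\<exists>c\<in>C. R c a b)"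
    \<comment> \<open>Ramsey's theorem colours unordered sets; \<open>Min\<close> and
      \<open>Max\<close> recover the order of the pair.\<close>
    define f where "f = (\<lambda>X. SOME n. n < card C \<and> R (e n) (Min X) (Max X))"
    have f: "f {a, b} < card C \<and> R (e (f {a, b})) a b" if "a < b" "b < N" for a b
    proof -
      obtain c where c: "c \<in> C" "R c a b" using R \<open>a < b\<close> \<open>b < N\<close> by blast
      have "c \<in> e ` {..<card C}" using c(1) bij_betw_imp_surj_on[OF e] by simp
      then have "\<exists>n. n < card C \<and> R (e n) a b" using c(2) by auto
      moreover have "f {a, b} = (SOME n. n < card C \<and> R (e n) a b)"
        using that(1) by (simp add: f_def)
      ultimately show ?thesis
        using someI_ex[of "\<lambda>n. n < card C \<and> R (e n) a b"] by simp
    qed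
    have "f \<in> nsets {..<N} 2 \<rightarrow> {..<length (replicate (card C) q)}"
      using f by (auto simp: ordered_nsets_2_eq)
    then obtain i where i: "i < card C"
        and "monochromatic {..<N} (replicate (card C) q ! i) 2 f i"
      using N unfolding partn_lst_def by fastforce
    then obtain H where H: "H \<in> nsets {..<N} q" "f ` nsets H 2 \<subseteq> {i}"
      unfolding monochromatic_def by auto
    have "R (e i) a b" if "a \<in> H" "b \<in> H" "a < b" for a b
    proof -
      have "{a, b} \<in> nsets H 2" using that by simp
      then have "f {a, b} = i" using H(2) by blast
      moreover have "b < N" using H(1) that by (auto simp: nsets_def)
      ultimately show ?thesis using f that by metis
    qed
    moreover have "e i \<in> C" using e i by (auto simp: bij_betw_def)
    ultimately show "\<exists>c\<in>C. \<exists>H\<subseteq>{..<N}. card H = q \<and> (\<forall>a\<in>H. \<forall>b\<in>H. a < b \<longrightarrow> R c a b)"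
      using H(1) by (auto simp: nsets_def)
  qed
qed

section \<open>Induced subgraphs from vertex embeddings\<close>

lemma pair_graph_imp_wf: "pair_graph G \<Longrightarrow> pair_wf_digraph G"
  unfolding pair_graph_def pair_digraph_def pair_fin_digraph_def by blast

text \<open>The subgraph \<open>K\<close> induced on the image of \<open>f\<close> is a copy of
  \<open>H\<close>. Since \<open>induced_free\<close> asks for an isomorphism from \<open>K\<close>
  to \<open>H\<close>, the inverse \<open>g\<close> of \<open>f\<close> supplies it. Refuting
  freeness thus becomes a check of adjacencies.\<close>

lemma not_induced_free_if_embedding:
  assumes "pair_wf_digraph G" "inj_on f (pverts H)" "f ` pverts H \<subseteq> pverts G"
    and wfH: "pair_wf_digraph H"
    and arcs: "\<And>u v. u \<in> pverts H \<Longrightarrow> v \<in> pverts H \<Longrightarrow> (u, v) \<in> parcs H \<longleftrightarrow> (f u, f v) \<in> parcs G"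
  shows "\<not> induced_free (with_proj H) (with_proj G)"
proof -
  interpret G: pair_wf_digraph G by fact
  interpret H: pair_wf_digraph H by fact
  define W where "W = f ` pverts H"
  define K where "K = \<lparr> pverts = W, parcs = {(u, v) \<in> parcs G. u \<in> W \<and> v \<in> W} \<rparr>"
  define g where "g = inv_into (pverts H) f"
  have wfK: "pair_wf_digraph K" by standard (auto simp: K_def)
  have gf: "g (f u) = u" if "u \<in> pverts H" for u
    using assms(2) that by (simp add: g_def)
  have fwd: "(f u, f v) \<in> parcs G \<and> u \<in> pverts H \<and> v \<in> pverts H" if "(u, v) \<in> parcs H" for u v
    using that arcs H.in_arcsD1 H.in_arcsD2 by blast
  have parcs_K: "parcs K = map_prod f f ` parcs H"
  proof
    show "parcs K \<subseteq> map_prod f f ` parcs H"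
      by (auto simp: K_def W_def map_prod_def arcs[symmetric] image_iff)
    show "map_prod f f ` parcs H \<subseteq> parcs K"
      using fwd by (auto simp: K_def W_def)
  qed
  have "digraph_iso (with_proj K) (with_proj H)"
  proof (subst digraph_iso_with_proj_iff[OF wfK], intro exI conjI)
    show "inj_on g (pverts K)"
      by (auto simp: K_def W_def g_def intro: inj_on_inv_into)
    show "pverts H = g ` pverts K"
      by (auto simp: K_def W_def gf image_image)
    have "map_prod g g (map_prod f f a) = a" if "a \<in> parcs H" for a
      using that H.in_arcsD1 H.in_arcsD2 by (cases a) (auto simp: gf)
    then show "parcs H = map_prod g g ` parcs K"
      unfolding parcs_K image_image by simp
  qed
  moreover have "induced_subgraph (with_proj K) (with_proj G)"
    using G.wf_digraph wfK assms(3)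
    by (auto simp: induced_subgraph_def subgraph_def compatible_def wf_digraph_wp_iff K_def W_def)
  ultimately show ?thesis unfolding induced_free_def by blast
qed

section \<open>Colourings and criticality\<close>

text \<open>An injective numbering of the vertices is a proper colouring, so the
  \<open>LEAST\<close> in \<open>chromatic_number\<close> is attained.\<close>

lemma proper_colouring_exists:
  assumes "finite (verts G)" "\<And>u v. u \<rightarrow>\<^bsub>G\<^esub> v \<Longrightarrow> u \<in> verts G \<and> v \<in> verts G \<and> u \<noteq> v"
  shows "\<exists>c. proper_colouring G (chromatic_number G) c"
  unfolding chromatic_number_def
proof (rule LeastI_ex)
  obtain c :: "'a \<Rightarrow> nat" where c: "inj_on c (verts G)"
    using finite_imp_inj_to_nat_seg[OF assms(1)] by blast
  \<comment> \<open>Without vertices \<open>Max\<close> is unspecified, but the inclusion is then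
    trivial.\<close>
  have "c ` verts G \<subseteq> {..<Suc (Max (c ` verts G))}"
    using assms(1) by (auto simp: less_Suc_eq_le)
  then show "\<exists>n c. proper_colouring G n c"
    using c assms(2) unfolding proper_colouring_def by (metis inj_onD)
qed

text \<open>If every neighbour of \<open>s\<close> were a neighbour of \<open>t\<close>, an optimal
  colouring of \<open>G - s\<close> would extend to \<open>G\<close> by giving \<open>s\<close> the
  colour of \<open>t\<close>, against criticality.\<close>

lemma (in pair_graph) critical_neighbourhoods_incomparable:
  assumes "vertex_critical k (with_proj G)" "s \<in> pverts G" "t \<in> pverts G" "s \<noteq> t"
  obtains x where "(s, x) \<in> parcs G" "(t, x) \<notin> parcs G"
proof (rule ccontr)
  assume "\<not> thesis"
  with that have sub: "(t, x) \<in> parcs G" if "(s, x) \<in> parcs G" for x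
    using that by blast
  let ?D = "pre_digraph.del_vert (with_proj G) s"
  have dom: "u \<rightarrow>\<^bsub>?D\<^esub> v \<longleftrightarrow> (u, v) \<in> parcs G \<and> u \<noteq> s \<and> v \<noteq> s" for u v
    by (force simp: arcs_ends_conv verts_del_vert arcs_del_vert tail_del_vert head_del_vert)
  have "\<exists>c. proper_colouring ?D (chromatic_number ?D) c"
    by (rule proper_colouring_exists)
      (auto simp: verts_del_vert dom pair_finite_verts dest: in_arcsD1 in_arcsD2 pair_no_loops)
  then obtain c where c: "proper_colouring ?D (chromatic_number ?D) c" ..
  have "(t, s) \<notin> parcs G"
    using sub arcs_symmetric pair_no_loops by fastforce
  have "proper_colouring (with_proj G) (chromatic_number ?D) (c(s := c t))"
    unfolding proper_colouring_def
  proof (intro conjI allI impI)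
    show "(c(s := c t)) ` verts (with_proj G) \<subseteq> {..<chromatic_number ?D}"
      using c assms(3,4) by (auto simp: proper_colouring_def verts_del_vert)
    fix u v assume "u \<rightarrow>\<^bsub>with_proj G\<^esub> v"
    then have uv: "(u, v) \<in> parcs G" by simp
    have ne: "c a \<noteq> c b" if "(a, b) \<in> parcs G" "a \<noteq> s" "b \<noteq> s" for a b
      using c that by (auto simp: proper_colouring_def dom)
    show "(c(s := c t)) u \<noteq> (c(s := c t)) v"
      using uv ne[of u v] ne[of t v] ne[of u t] assms(4) sub arcs_symmetric pair_no_loops[OF uv]
      by auto
  qed
  then have "chromatic_number (with_proj G) \<le> chromatic_number ?D"
    unfolding chromatic_number_def by (intro Least_le) blast
  with assms(1,2) show False by (auto simp: vertex_critical_def)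
qed

section \<open>Exhibiting the forbidden subgraphs\<close>

text \<open>Otherwise the edges \<open>sx\<close> and \<open>ty\<close> would induce
  \<open>2P_2\<close>.\<close>

lemma (in pair_graph) two_P2_free_adjacent:
  assumes free: "induced_free (with_proj (copies 2 (path_graph 2))) (with_proj G)"
    and "(s, x) \<in> parcs G" "(t, y) \<in> parcs G"
    and "(s, t) \<notin> parcs G" "(t, x) \<notin> parcs G" "(s, y) \<notin> parcs G"
  shows "(x, y) \<in> parcs G"
proof (rule ccontr)
  assume nxy: "(x, y) \<notin> parcs G"
  define f where "f p = (if fst p = 0 then if snd p = 0 then s else x
    else if snd p = 0 then t else y)" for p :: "nat \<times> nat"
  have f_simps [simp]: "f (0, 0) = s" "f (0, Suc 0) = x" "f (Suc 0, 0) = t" "f (Suc 0, Suc 0) = y"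
    by (simp_all add: f_def)
  have sym: "(v, u) \<in> parcs G \<longleftrightarrow> (u, v) \<in> parcs G" for u v
    using arcs_symmetric by blast
  have loop: "(v, v) \<notin> parcs G" for v using pair_no_loops by fastforce
  have rev: "(x, s) \<in> parcs G" "(y, t) \<in> parcs G" "(t, s) \<notin> parcs G" "(x, t) \<notin> parcs G"
    "(y, s) \<notin> parcs G" "(y, x) \<notin> parcs G"
    using assms(2-) nxy sym by metis+
  have V: "pverts (copies 2 (path_graph 2)) = {(0,0), (0,1), (1,0), (1,1)}"
    by (auto simp: copies_def path_graph_def)
  have A: "parcs (copies 2 (path_graph 2))
      = {((0,0),(0,1)), ((0,1),(0,0)), ((1,0),(1,1)), ((1,1),(1,0))}"
    by (auto simp: copies_def path_graph_def less_2_cases_iff)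
  have "\<not> induced_free (with_proj (copies 2 (path_graph 2))) (with_proj G)"
  proof (rule not_induced_free_if_embedding[where f = f])
    show "pair_wf_digraph G" by unfold_locales
    show "pair_wf_digraph (copies 2 (path_graph 2))"
      by (intro pair_graph_imp_wf pair_graph_copies pair_graph_path_graph)
    \<comment> \<open>Distinctness comes from adjacency alone: identifying two of the vertices would
      create a loop or turn a non-edge into an edge.\<close>
    have "s \<noteq> x" "s \<noteq> t" "s \<noteq> y" "x \<noteq> t" "x \<noteq> y" "t \<noteq> y"
      using assms(2-) nxy loop sym by metis+
    then show "inj_on f (pverts (copies 2 (path_graph 2)))"
      unfolding V by (auto simp: inj_on_def)
    show "f ` pverts (copies 2 (path_graph 2)) \<subseteq> pverts G"
      unfolding V using assms(2,3) in_arcsD1 in_arcsD2 by auto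
    show "(u, v) \<in> parcs (copies 2 (path_graph 2)) \<longleftrightarrow> (f u, f v) \<in> parcs G"
      if "u \<in> pverts (copies 2 (path_graph 2))" "v \<in> pverts (copies 2 (path_graph 2))" for u v
      using that assms(2-) nxy rev loop unfolding V A by (elim insertE emptyE; simp)
  qed
  with free show False by blast
qed

text \<open>The path is \<open>s\<close>, \<open>x\<close>, \<open>y\<close>, \<open>t\<close>, and
  \<open>T\<close> supplies the isolated vertices. That \<open>x\<close> and \<open>y\<close> lie
  outside \<open>T\<close> follows because \<open>x\<close> is adjacent to \<open>s\<close> and
  \<open>y\<close> to \<open>t\<close>, while no vertex of \<open>T\<close> is adjacent to either
  end.\<close>

lemma (in pair_graph) P4_plus_isolated_not_induced_free:
  assumes "(s, x) \<in> parcs G" "(x, y) \<in> parcs G" "(y, t) \<in> parcs G"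
    and "(s, y) \<notin> parcs G" "(x, t) \<notin> parcs G"
    and T: "T \<subseteq> pverts G" "s \<notin> T" "t \<notin> T" "finite T" "card T = l"
    and ind: "\<And>u v. u \<in> insert s (insert t T) \<Longrightarrow> v \<in> insert s (insert t T) \<Longrightarrow> (u, v) \<notin> parcs G"
    and nxT: "\<And>u. u \<in> T \<Longrightarrow> (x, u) \<notin> parcs G" "\<And>u. u \<in> T \<Longrightarrow> (y, u) \<notin> parcs G"
  shows "\<not> induced_free
    (with_proj (disjoint_union (path_graph 4) (copies l (path_graph 1)))) (with_proj G)"
proof -
  let ?H = "disjoint_union (path_graph 4) (copies l (path_graph 1))"
  obtain h where h: "bij_betw h {..<l} T"
    using ex_bij_betw_nat_finite[OF T(4)] T(5) by (auto simp: atLeast0LessThan)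
  define f where "f p = (case p of
      Inl i \<Rightarrow> if i = 0 then s else if i = 1 then x else if i = 2 then y else t
    | Inr q \<Rightarrow> h (fst q))" for p :: "nat + nat \<times> nat"
  have sym: "(v, u) \<in> parcs G \<longleftrightarrow> (u, v) \<in> parcs G" for u v
    using arcs_symmetric by blast
  have loop: "(v, v) \<notin> parcs G" for v using pair_no_loops by fastforce
  have hT: "h i \<in> T" if "i < l" for i using h that by (auto simp: bij_betw_def)
  have h_inj: "h i = h j \<longleftrightarrow> i = j" if "i < l" "j < l" for i j
    using h that by (auto simp: bij_betw_def inj_on_def)
  have f_simps [simp]: "f (Inl 0) = s" "f (Inl (Suc 0)) = x" "f (Inl 2) = y" "f (Inl 3) = t"
    "f (Inr q) = h (fst q)" for q
    by (simp_all add: f_def)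
  have V: "pverts ?H = {Inl 0, Inl 1, Inl 2, Inl 3} \<union> (\<lambda>i. Inr (i, 0)) ` {..<l}"
  proof -
    have "{..<4::nat} = {0, 1, 2, 3}" by auto
    then show ?thesis
      by (auto simp: disjoint_union_def copies_def path_graph_def)
  qed
  have A: "parcs ?H = {(Inl 0, Inl 1), (Inl 1, Inl 0), (Inl 1, Inl 2), (Inl 2, Inl 1),
      (Inl 2, Inl 3), (Inl 3, Inl 2)}"
  proof -
    have "{(i, j). i < 4 \<and> j < 4 \<and> (j = Suc i \<or> i = Suc j)}
        = {(0, 1), (1, 0), (1, 2), (2, 1), (2, 3), (3, 2)}"
      by auto
    then show ?thesis
      by (simp add: disjoint_union_def copies_def path_graph_def)
  qed
  have rev: "(x, s) \<in> parcs G" "(y, x) \<in> parcs G" "(t, y) \<in> parcs G" "(y, s) \<notin> parcs G"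
    "(t, x) \<notin> parcs G" "(s, t) \<notin> parcs G" "(t, s) \<notin> parcs G"
    using assms(1-5) sym ind[of s t] ind[of t s] by auto
  have ne: "s \<noteq> x" "s \<noteq> y" "s \<noteq> t" "x \<noteq> y" "x \<noteq> t" "y \<noteq> t"
    using assms(1-5) loop sym ind[of s t] by (metis insertI1 insertI2)+
  have nT: "u \<noteq> s" "u \<noteq> t" "u \<noteq> x" "u \<noteq> y" if "u \<in> T" for u
    using that T(2,3) ind[of s u] ind[of t u] assms(1,3) sym by auto
  have nTs: "(s, u) \<notin> parcs G" "(t, u) \<notin> parcs G" "(x, u) \<notin> parcs G" "(y, u) \<notin> parcs G"
    "(u, s) \<notin> parcs G" "(u, t) \<notin> parcs G" "(u, x) \<notin> parcs G" "(u, y) \<notin> parcs G" if "u \<in> T" for u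
    using that ind[of s u] ind[of t u] nxT[of u] sym by auto
  have nTT: "(u, v) \<notin> parcs G" if "u \<in> T" "v \<in> T" for u v
    using that ind by blast
  show ?thesis
  proof (rule not_induced_free_if_embedding[where f = f])
    show "pair_wf_digraph G" by unfold_locales
    show "pair_wf_digraph ?H"
      by (intro pair_graph_imp_wf pair_graph_disjoint_union pair_graph_copies pair_graph_path_graph)
    show "inj_on f (pverts ?H)"
      unfolding V inj_on_def using ne nT[OF hT] by (auto simp: h_inj)
    show "f ` pverts ?H \<subseteq> pverts G"
      unfolding V using assms(1,3) in_arcsD1 in_arcsD2 hT T(1) by auto
    show "(u, v) \<in> parcs ?H \<longleftrightarrow> (f u, f v) \<in> parcs G" if "u \<in> pverts ?H" "v \<in> pverts ?H" for u v
      using that unfolding V A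
      by (elim UnE insertE emptyE imageE; simp add: assms(1-5) rev loop nTs[OF hT] nTT[OF hT hT])
  qed
qed

section \<open>Bounding a colour class\<close>

text \<open>The Ramsey property of \<open>N\<close> is a hypothesis so that one \<open>N\<close>
  serves every graph and every class. Its colours are pairs \<open>(i, j)\<close> of colour classes;
  the size \<open>l + 2\<close> provides the two ends of \<open>P_4\<close> and \<open>l\<close>
  isolated vertices.\<close>

lemma (in pair_graph) colour_class_card_less:
  fixes c :: "'a \<Rightarrow> nat"
  assumes crit: "vertex_critical k (with_proj G)"
    and P4: "induced_free (with_proj (disjoint_union (path_graph 4) (copies l (path_graph 1)))) (with_proj G)"
    and P2: "induced_free (with_proj (copies 2 (path_graph 2))) (with_proj G)"
    and c: "proper_colouring (with_proj G) k c"
    and N: "\<forall>R :: nat \<times> nat \<Rightarrow> nat \<Rightarrow> nat \<Rightarrow> bool.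
      (\<forall>a b. a < b \<and> b < N \<longrightarrow> (\<exists>ij\<in>{..<k} \<times> {..<k}. R ij a b)) \<longrightarrow>
      (\<exists>ij\<in>{..<k} \<times> {..<k}. \<exists>H\<subseteq>{..<N}. card H = l + 2 \<and> (\<forall>a\<in>H. \<forall>b\<in>H. a < b \<longrightarrow> R ij a b))"
  shows "card {v \<in> pverts G. c v = m} < N"
proof (rule ccontr)
  let ?S = "{v \<in> pverts G. c v = m}"
  assume "\<not> card ?S < N"
  then obtain S where S: "S \<subseteq> ?S" "card S = N" "finite S"
    by (meson obtain_subset_with_card_n not_less)
  obtain s where s: "bij_betw s {..<N} S"
    using ex_bij_betw_nat_finite[OF S(3)] S(2) by (auto simp: atLeast0LessThan)
  have sS: "s a \<in> ?S" if "a < N" for a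
    using s S(1) that by (auto simp: bij_betw_def)
  have s_inj: "s a = s b \<longleftrightarrow> a = b" if "a < N" "b < N" for a b
    using s that by (auto simp: bij_betw_def inj_on_def)
  have sym: "(v, u) \<in> parcs G \<longleftrightarrow> (u, v) \<in> parcs G" for u v
    using arcs_symmetric by blast
  have same: "(u, v) \<notin> parcs G" if "c u = c v" for u v
    using c that by (auto simp: proper_colouring_def)
  have c_less: "c v < k" if "v \<in> pverts G" for v
    using c that by (auto simp: proper_colouring_def)
  define Nb where "Nb i a = {x. (s a, x) \<in> parcs G \<and> c x = i}" for i a
  \<comment> \<open>Criticality gives a neighbour \<open>x\<close> of \<open>s b\<close> not
    adjacent to \<open>s a\<close>, and \<open>i\<close> is its colour. A neighbour \<open>y\<close>
    of \<open>s a\<close> of that colour missing from \<open>Nb i b\<close> would be adjacent to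
    \<open>x\<close> by \<open>2P_2\<close>-freeness, although both have the same colour.\<close>
  have step: "\<exists>i<k. Nb i a \<subset> Nb i b" if ab: "a < N" "b < N" "a \<noteq> b" for a b
  proof -
    obtain x where x: "(s b, x) \<in> parcs G" "(s a, x) \<notin> parcs G"
      using critical_neighbourhoods_incomparable[OF crit, of "s b" "s a"] sS s_inj ab by blast
    have "Nb (c x) a \<subseteq> Nb (c x) b"
    proof
      fix y assume "y \<in> Nb (c x) a"
      then have y: "(s a, y) \<in> parcs G" "c y = c x" by (auto simp: Nb_def)
      have "(s b, s a) \<notin> parcs G" using sS[OF ab(1)] sS[OF ab(2)] by (intro same) auto
      then show "y \<in> Nb (c x) b"
        using two_P2_free_adjacent[OF P2 x(1) y(1)] x(2) y same[of x y] by (auto simp: Nb_def)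
    qed
    moreover have "x \<in> Nb (c x) b - Nb (c x) a" using x by (auto simp: Nb_def)
    ultimately show ?thesis using c_less in_arcsD2[OF x(1)] by blast
  qed
  define R where "R ij a b \<longleftrightarrow> Nb (fst ij) a \<subset> Nb (fst ij) b \<and> Nb (snd ij) b \<subset> Nb (snd ij) a"
    for ij :: "nat \<times> nat" and a b
  have "\<forall>a b. a < b \<and> b < N \<longrightarrow> (\<exists>ij\<in>{..<k} \<times> {..<k}. R ij a b)"
  proof (intro allI impI)
    fix a b assume "a < b \<and> b < N"
    then obtain i j where "i < k" "j < k" "Nb i a \<subset> Nb i b" "Nb j b \<subset> Nb j a"
      using step[of a b] step[of b a] by auto
    then show "\<exists>ij\<in>{..<k} \<times> {..<k}. R ij a b"
      by (intro bexI[of _ "(i, j)"]) (auto simp: R_def)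
  qed
  then have "\<exists>ij\<in>{..<k} \<times> {..<k}. \<exists>H\<subseteq>{..<N}. card H = l + 2 \<and> (\<forall>a\<in>H. \<forall>b\<in>H. a < b \<longrightarrow> R ij a b)"
    by (rule N[THEN spec, THEN mp])
  then obtain ij H where H: "H \<subseteq> {..<N}" "card H = l + 2"
      "\<And>a b. a \<in> H \<Longrightarrow> b \<in> H \<Longrightarrow> a < b \<Longrightarrow> R ij a b"
    by blast
  define i where "i = fst ij"
  define j where "j = snd ij"
  have i: "Nb i a \<subset> Nb i b" and j: "Nb j b \<subset> Nb j a" if "a \<in> H" "b \<in> H" "a < b" for a b
    using H(3)[OF that] by (auto simp: R_def i_def j_def)
  have finH: "finite H" using H(1) finite_subset by blast
  define M where "M = Max H"
  define m0 where "m0 = Min H"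
  \<comment> \<open>\<open>p\<close> is the second largest and \<open>q\<close> the second smallest
    element of \<open>H\<close>. Along \<open>H\<close> the sets \<open>Nb i\<close> increase and
    the sets \<open>Nb j\<close> decrease, so a vertex of \<open>Nb i M\<close> outside
    \<open>Nb i p\<close> has no neighbour \<open>s a\<close> with \<open>a\<close> in
    \<open>H\<close> other than \<open>s M\<close>; likewise for \<open>m0\<close> and
    \<open>q\<close> with \<open>Nb j\<close>. For \<open>l = 0\<close>, \<open>p = m0\<close> and
    \<open>q = M\<close>.\<close>
  define p where "p = Max (H - {M})"
  define q where "q = Min (H - {m0})"
  have ne: "H \<noteq> {}" using H(2) by auto
  have "card (H - {M}) \<noteq> 0" "card (H - {m0}) \<noteq> 0"
    using H(2) finH by (auto simp: card_Diff_singleton_if)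
  then have ne': "H - {M} \<noteq> {}" "H - {m0} \<noteq> {}" by (auto simp only: card.empty)
  have MH: "M \<in> H" and m0H: "m0 \<in> H" using finH ne by (auto simp: M_def m0_def)
  have pH: "p \<in> H - {M}" and qH: "q \<in> H - {m0}"
    unfolding p_def q_def using finH ne' by (intro Max_in Min_in; simp)+
  have p_max: "a \<le> p" if "a \<in> H - {M}" for a using that finH by (auto simp: p_def)
  have q_min: "q \<le> a" if "a \<in> H - {m0}" for a using that finH by (auto simp: q_def)
  have pM: "p < M" using pH finH by (auto simp: M_def order.not_eq_order_implies_strict)
  have mq: "m0 < q" using qH finH by (auto simp: m0_def order.not_eq_order_implies_strict)
  obtain x where x: "x \<in> Nb i M" "x \<notin> Nb i p" using i[of p M] pH MH pM by blast
  obtain y where y: "y \<in> Nb j m0" "y \<notin> Nb j q" using j[of m0 q] qH m0H mq by blast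
  have nx: "(s a, x) \<notin> parcs G" if "a \<in> H - {M}" for a
  proof -
    have "Nb i a \<subseteq> Nb i p" using i[of a p] p_max[OF that] that pH by (cases "a = p") auto
    with x show ?thesis by (auto simp: Nb_def)
  qed
  have ny: "(s a, y) \<notin> parcs G" if "a \<in> H - {m0}" for a
  proof -
    have "Nb j a \<subseteq> Nb j q" using j[of q a] q_min[OF that] that qH by (cases "a = q") auto
    with y show ?thesis by (auto simp: Nb_def)
  qed
  have mM: "m0 \<noteq> M" using pH pM Min_le[OF finH, of p] by (auto simp: m0_def)
  have HN: "a < N" if "a \<in> H" for a using H(1) that by auto
  have xM: "(s M, x) \<in> parcs G" and ym: "(s m0, y) \<in> parcs G"
    using x y by (auto simp: Nb_def)
  have ind: "(s a, s b) \<notin> parcs G" if "a \<in> H" "b \<in> H" for a b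
    using sS[OF HN[OF that(1)]] sS[OF HN[OF that(2)]] by (intro same) auto
  define T where "T = s ` (H - {M, m0})"
  have inj: "inj_on s H" using s_inj HN by (auto simp: inj_on_def)
  have "\<not> induced_free (with_proj (disjoint_union (path_graph 4) (copies l (path_graph 1)))) (with_proj G)"
  \<comment> \<open>The path is \<open>s M\<close>, \<open>x\<close>, \<open>y\<close>,
    \<open>s m0\<close>; its middle edge is forced by \<open>2P_2\<close>-freeness.\<close>
  proof (rule P4_plus_isolated_not_induced_free)
    show "(s M, x) \<in> parcs G" by (fact xM)
    show "(x, y) \<in> parcs G"
      using two_P2_free_adjacent[OF P2 xM ym] ind MH m0H nx[of m0] ny[of M] mM by auto
    show "(y, s m0) \<in> parcs G" using ym sym by blast
    show "(s M, y) \<notin> parcs G" "(x, s m0) \<notin> parcs G"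
      using ny[of M] nx[of m0] MH m0H mM sym by auto
    show "T \<subseteq> pverts G" using sS HN by (auto simp: T_def)
    show "s M \<notin> T" "s m0 \<notin> T"
      using s_inj HN MH m0H by (auto simp: T_def)
    show "finite T" using finH by (simp add: T_def)
    have "card T = card (H - {M, m0})"
      unfolding T_def using inj by (intro card_image) (auto intro: inj_on_subset)
    also have "\<dots> = l" using H(2) MH m0H mM finH by (subst card_Diff_subset) auto
    finally show "card T = l" .
    show "(u, v) \<notin> parcs G" if "u \<in> insert (s M) (insert (s m0) T)"
      "v \<in> insert (s M) (insert (s m0) T)" for u v
      using that ind MH m0H by (auto simp: T_def)
    show "(x, u) \<notin> parcs G" "(y, u) \<notin> parcs G" if "u \<in> T" for u
      using that nx ny sym by (auto simp: T_def)
  qed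
  with P4 show False by blast
qed

section \<open>Finitely many isomorphism types\<close>

lemma finite_pair_digraphs_on:
  fixes V :: "'a set"
  assumes "finite V"
  shows "finite {H :: 'a pair_pre_digraph. pverts H \<subseteq> V \<and> parcs H \<subseteq> V \<times> V}"
proof (rule finite_subset)
  show "{H :: 'a pair_pre_digraph. pverts H \<subseteq> V \<and> parcs H \<subseteq> V \<times> V}
      \<subseteq> (\<lambda>(P, A). \<lparr> pverts = P, parcs = A \<rparr>) ` (Pow V \<times> Pow (V \<times> V))"
  proof
    fix H :: "'a pair_pre_digraph" assume "H \<in> {H. pverts H \<subseteq> V \<and> parcs H \<subseteq> V \<times> V}"
    then show "H \<in> (\<lambda>(P, A). \<lparr> pverts = P, parcs = A \<rparr>) ` (Pow V \<times> Pow (V \<times> V))"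
      by (intro image_eqI[of _ _ "(pverts H, parcs H)"]) auto
  qed
  show "finite ((\<lambda>(P, A). \<lparr> pverts = P, parcs = A \<rparr>) ` (Pow V \<times> Pow (V \<times> V)))"
    using assms by simp
qed

lemma (in pair_fin_digraph) iso_to_nat_digraph:
  assumes "card (pverts G) \<le> n"
  obtains H :: "nat pair_pre_digraph"
  where "pverts H \<subseteq> {..<n}" "parcs H \<subseteq> {..<n} \<times> {..<n}" "digraph_iso (with_proj G) (with_proj H)"
proof -
  obtain g where "bij_betw g (pverts G) {0..<card (pverts G)}"
    using ex_bij_betw_finite_nat[OF pair_finite_verts] by blast
  then have g: "inj_on g (pverts G)" "g ` pverts G \<subseteq> {..<n}"
    using assms by (auto simp: bij_betw_def)
  define H where "H = \<lparr> pverts = g ` pverts G, parcs = map_prod g g ` parcs G \<rparr>"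
  have wf: "pair_wf_digraph G" by unfold_locales
  have iso: "digraph_iso (with_proj G) (with_proj H)"
    unfolding digraph_iso_with_proj_iff[OF wf] using g(1) by (auto simp: H_def intro!: exI[of _ g])
  have "parcs H \<subseteq> {..<n} \<times> {..<n}"
    using g(2) in_arcsD1 in_arcsD2 by (fastforce simp: H_def)
  with that[of H] g(2) iso show thesis by (auto simp: H_def)
qed

theorem theorem2:
  fixes k l :: nat
  assumes "k \<ge> 1"
  shows "\<exists>F :: nat pair_pre_digraph set. finite F \<and>
    (\<forall>G :: 'a pair_pre_digraph.
       pair_graph G \<and>
       vertex_critical k (with_proj G) \<and>
       induced_free (with_proj (disjoint_union (path_graph 4) (copies l (path_graph 1)))) (with_proj G) \<and>
       induced_free (with_proj (copies 2 (path_graph 2))) (with_proj G)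
       \<longrightarrow> (\<exists>H \<in> F. digraph_iso (with_proj G) (with_proj H)))"
proof -
  obtain N where N: "\<forall>R :: nat \<times> nat \<Rightarrow> nat \<Rightarrow> nat \<Rightarrow> bool.
      (\<forall>a b. a < b \<and> b < N \<longrightarrow> (\<exists>ij\<in>{..<k} \<times> {..<k}. R ij a b)) \<longrightarrow>
      (\<exists>ij\<in>{..<k} \<times> {..<k}. \<exists>H\<subseteq>{..<N}. card H = l + 2 \<and> (\<forall>a\<in>H. \<forall>b\<in>H. a < b \<longrightarrow> R ij a b))"
    using ramsey_ordered_pairs[of "{..<k} \<times> {..<k}" "l + 2"] by auto
  \<comment> \<open>\<open>F\<close> need not consist of critical graphs: it collects all digraphs
    small enough to represent a graph with \<open>k\<close> colour classes of at most
    \<open>N\<close> vertices each. It depends only on \<open>k\<close> and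
    \<open>l\<close>.\<close>
  define F :: "nat pair_pre_digraph set"
    where "F = {H. pverts H \<subseteq> {..<k * N} \<and> parcs H \<subseteq> {..<k * N} \<times> {..<k * N}}"
  show ?thesis
  proof (intro exI[of _ F] conjI allI impI)
    show "finite F" unfolding F_def by (rule finite_pair_digraphs_on) simp
    fix G :: "'a pair_pre_digraph"
    assume G: "pair_graph G \<and> vertex_critical k (with_proj G) \<and>
       induced_free (with_proj (disjoint_union (path_graph 4) (copies l (path_graph 1)))) (with_proj G) \<and>
       induced_free (with_proj (copies 2 (path_graph 2))) (with_proj G)"
    then interpret pair_graph G by blast
    have "\<exists>c. proper_colouring (with_proj G) (chromatic_number (with_proj G)) c"
      by (rule proper_colouring_exists)
        (auto simp: pair_finite_verts dest: in_arcsD1 in_arcsD2 pair_no_loops)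
    then obtain c where c: "proper_colouring (with_proj G) k c"
      using G by (auto simp: vertex_critical_def)
    have "pverts G = (\<Union>m<k. {v \<in> pverts G. c v = m})"
      using c by (auto simp: proper_colouring_def)
    then have "card (pverts G) \<le> (\<Sum>m<k. card {v \<in> pverts G. c v = m})"
      by (metis card_UN_le finite_lessThan)
    also have "\<dots> \<le> (\<Sum>m<k. N)"
      using G c N by (intro sum_mono less_imp_le colour_class_card_less) auto
    finally have "card (pverts G) \<le> k * N" by simp
    then show "\<exists>H\<in>F. digraph_iso (with_proj G) (with_proj H)"
      by (rule iso_to_nat_digraph) (auto simp: F_def)
  qed
qed

end
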